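(* Let $m\ge 3$ and let $C_m$ be the $m$-cycle on $[m]$. A matrix $\Sigma=(\sigma_{ij})\in\mathbb{S}^m_{\succeq 0}(C_m)$ is in the image of $\phi_{C_m}$ if and only if $$\sum_{M\in\mathcal{M}(C_m)}(-1)^{|M|}\prod_{\{i,j\}\in M}\sigma_{ij}^2\prod_{i\in[m]\setminus M}\sigma_{ii}\;\ge\;2\prod_{i=1}^m|\sigma_{i,i+1}|,$$ where indices are read modulo $m$, so that $\sigma_{m,m+1}=\sigma_{1m}$.
   Context: Notation: $[m]=\{1,\dots,m\}$. $C_m$ is the chordless cycle with vertex set $[m]$ and edges $\{1,2\},\{2,3\},\dots,\{m-1,m\},\{1,m\}$. $\mathbb{S}^m_{\succeq 0}(C_m)$ is the set of real symmetric positive semidefinite $m\times m$ matrices $(\sigma_{ij})$ with $\sigma_{ij}=0$ whenever $i\ne j$ and $\{i,j\}$ is not an edge of $C_m$. $\mathcal{M}(C_m)$ is the set of all (not necessarily maximal, possibly empty) matchings of $C_m$, i.e. sets $M$ of pairwise disjoint edges of $C_m$; $[m]\setminus M$ denotes the set of vertices not incident to any edge in $M$. For a simplicial complex $\Delta$ on $[m]$, the map $\phi_\Delta$ sends $\gamma=(\gamma_{i,F}:F\in\Delta,\ i\in F)$, with real entries, to $\Gamma(\gamma)\Gamma(\gamma)^T$, where $\Gamma(\gamma)$ is the $[m]\times\Delta$ matrix with entries $\Gamma(\gamma)_{i,F}=\gamma_{i,F}$ if $i\in F$ and $0$ otherwise. $\phi_{C_m}$ denotes $\phi_\Delta$ for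 $\Delta$ the simplicial complex whose facets are the edges of $C_m$ (so its non-empty faces are the singletons and the edges). Explicitly, with $\gamma_i=\gamma_{i,\{i\}}$ and $\gamma_{ij}=\gamma_{i,\{i,j\}}$, the $(i,i)$ entry of $\phi_{C_m}(\gamma)$ is $\gamma_i^2+\gamma_{i,i-1}^2+\gamma_{i,i+1}^2$, the $(i,j)$ entry for an edge $\{i,j\}$ is $\gamma_{ij}\gamma_{ji}$, and all other entries are $0$. *)

theory Defs
  imports Complex_Main "Jordan_Normal_Form.Matrix"
begin

text \<open>
  Matrices of size \<open>m\<close> are those of Jordan_Normal_Form, indexed by \<open>{..<m}\<close>.  The vertex set
  \<open>[m]\<close> is therefore \<open>{..<m}\<close>, and the successor of \<open>i\<close> modulo \<open>m\<close> is \<open>Suc i mod m\<close>.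
\<close>

definition cycle_edges :: "nat \<Rightarrow> nat set set" where
  "cycle_edges m = {{i, Suc i mod m} |i. i < m}"

definition psd :: "nat \<Rightarrow> real mat set" where
  "psd m = {S \<in> carrier_mat m m. transpose_mat S = S \<and>
     (\<forall>v \<in> carrier_vec m. 0 \<le> v \<bullet> (S *\<^sub>v v))}"

definition psd_graph :: "nat \<Rightarrow> nat set set \<Rightarrow> real mat set" where
  "psd_graph m E = {S \<in> psd m. \<forall>i<m. \<forall>j<m. i \<noteq> j \<and> {i, j} \<notin> E \<longrightarrow> S $$ (i, j) = 0}"

definition matchings :: "nat set set \<Rightarrow> nat set set set" where
  "matchings E = {M. M \<subseteq> E \<and> pairwise disjnt M}"

definition complex_of_facets :: "nat set set \<Rightarrow> nat set set" where
  "complex_of_facets \<F> = {F. \<exists>e\<in>\<F>. F \<subseteq> e}"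

definition Gam :: "(nat \<Rightarrow> nat set \<Rightarrow> real) \<Rightarrow> nat \<Rightarrow> nat set \<Rightarrow> real" where
  "Gam \<gamma> i F = (if i \<in> F then \<gamma> i F else 0)"

text \<open>
  The product of the \<open>[m] \<times> \<Delta>\<close> matrix \<^term>\<open>Gam \<gamma>\<close> with its transpose.  The columns are indexed
  by the faces of \<open>\<Delta>\<close>, so the product is written out as a sum over \<open>\<Delta>\<close>; the empty face
  contributes a zero column.  The parameters \<open>\<gamma> i F\<close> with \<open>F \<notin> \<Delta>\<close> or \<open>i \<notin> F\<close> are not used.
\<close>
definition phi :: "nat \<Rightarrow> nat set set \<Rightarrow> (nat \<Rightarrow> nat set \<Rightarrow> real) \<Rightarrow> real mat" where
  "phi m \<Delta> \<gamma> = mat m m (\<lambda>(i, j). \<Sum>F\<in>\<Delta>. Gam \<gamma> i F * Gam \<gamma> j F)"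

text \<open>
  The entry at an edge \<open>{i, j}\<close>; for a symmetric matrix the order of \<open>i\<close> and \<open>j\<close> is irrelevant.
\<close>
definition edge_entry :: "real mat \<Rightarrow> nat set \<Rightarrow> real" where
  "edge_entry S e = S $$ (Min e, Max e)"

end

theory Submission
  imports Defs
begin

text \<open>Put \<open>c\<^sub>i = \<sigma>\<^sub>i\<^sub>,\<^sub>i\<^sub>+\<^sub>1\<close>.  A matrix is in the image exactly if each diagonal entry dominates a sum of
  two contributions of its incident edges, \<open>\<sigma>\<^sub>i\<^sub>i \<ge> x\<^sub>i + y\<^sub>i\<^sub>-\<^sub>1\<close>, where \<open>x\<^sub>i, y\<^sub>i \<ge> 0\<close> and
  \<open>x\<^sub>i y\<^sub>i = c\<^sub>i\<^sup>2\<close>.  The signed sum over matchings is then at least \<open>\<Prod>x\<^sub>i + \<Prod>y\<^sub>i\<close> (with equality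
  if there is no slack on the diagonal), hence at least \<open>2\<Prod>\<bar>c\<^sub>i\<bar>\<close> by the inequality between the
  arithmetic and the geometric mean.  Conversely, if some \<open>c\<^sub>i\<close> vanishes, Gaussian elimination
  along the remaining path yields \<open>x\<close> and \<open>y\<close>.  Otherwise, the inequality says that the matrix with
  diagonal \<open>\<sigma>\<^sub>i\<^sub>i\<close> and entries \<open>- \<bar>c\<^sub>i\<bar>\<close> at the edges has nonnegative determinant, and a
  positive vector that this matrix maps to a nonnegative one yields \<open>x\<close> and \<open>y\<close>.\<close>

subsection \<open>Continuants\<close>

text \<open>Indices are shifted by one: \<open>cont a b l (Suc n)\<close> belongs to the path with vertices
  \<open>l, \<dots>, l + n - 1\<close>, so that \<open>cont a b l 0 = 0\<close> makes both recursions hold up to the boundary.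
  The truncated subtraction \<open>l + n - 1\<close> with \<open>l = n = 0\<close> is multiplied by zero.\<close>

fun cont :: "(nat \<Rightarrow> real) \<Rightarrow> (nat \<Rightarrow> real) \<Rightarrow> nat \<Rightarrow> nat \<Rightarrow> real" where
  "cont a b l 0 = 0"
| "cont a b l (Suc 0) = 1"
| "cont a b l (Suc (Suc n)) = a (l + n) * cont a b l (Suc n) - b (l + n - 1) * cont a b l n"

text \<open>Continuants are tridiagonal determinants, expanded here at the first instead of the last
  vertex. Both sides obey the same recursion in \<open>n\<close>, so two base cases suffice.\<close>

lemma cont_left:
  "cont a b l (Suc (Suc n)) = a l * cont a b (Suc l) (Suc n) - b l * cont a b (Suc (Suc l)) n"
proof (induction n rule: induct_nat_012)
  case (ge2 n)
  have "cont a b l (Suc (Suc (Suc (Suc n)))) =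
      a (l + Suc (Suc n)) * cont a b l (Suc (Suc (Suc n)))
      - b (l + Suc (Suc n) - 1) * cont a b l (Suc (Suc n))"
    by (rule cont.simps)
  also have "\<dots> = a l * cont a b (Suc l) (Suc (Suc (Suc n)))
      - b l * cont a b (Suc (Suc l)) (Suc (Suc n))"
    unfolding ge2 by (simp add: algebra_simps)
  finally show ?case .
qed (simp_all add: algebra_simps)

lemma cont_cong:
  assumes "\<And>i. l \<le> i \<Longrightarrow> a i = a' i"
  shows "cont a b l n = cont a' b l n"
  using assms by (induction n rule: induct_nat_012) auto

text \<open>Ratios of consecutive continuants are the pivots of Gaussian elimination. A pivot that
  is at least \<open>x i\<close> makes the next subtraction at most \<open>y i\<close>, so the next
  pivot is at least \<open>x (Suc i)\<close>. The form without quotients allows pivots to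
  vanish.\<close>

lemma cont_step_le:
  assumes "\<And>i. l \<le> i \<Longrightarrow> i < l + n \<Longrightarrow> 0 \<le> x i \<and> 0 \<le> y i"
    and "x l \<le> a l"
    and "\<And>i. l \<le> i \<Longrightarrow> Suc i < l + n \<Longrightarrow> b i = x i * y i \<and> x (Suc i) + y i \<le> a (Suc i)"
    and "k < n"
  shows "x (l + k) * cont a b l (Suc k) \<le> cont a b l (Suc (Suc k)) \<and> 0 \<le> cont a b l (Suc k)"
  using \<open>k < n\<close>
proof (induction k)
  case 0
  then show ?case using assms(2) by simp
next
  case (Suc k)
  let ?A = "cont a b l (Suc k)" and ?B = "cont a b l (Suc (Suc k))"
  have IH: "x (l + k) * ?A \<le> ?B" "0 \<le> ?A"
    using Suc by auto
  have nn: "0 \<le> x (l + k)" "0 \<le> y (l + k)"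
    using assms(1)[of "l + k"] Suc.prems by auto
  have *: "b (l + k) = x (l + k) * y (l + k)" "x (Suc (l + k)) + y (l + k) \<le> a (Suc (l + k))"
    using assms(3)[of "l + k"] Suc.prems by auto
  have B: "0 \<le> ?B"
    using IH nn by (meson mult_nonneg_nonneg order_trans)
  have "(x (Suc (l + k)) + y (l + k)) * ?B \<le> a (Suc (l + k)) * ?B"
    using * B by (intro mult_right_mono) auto
  moreover have "y (l + k) * (x (l + k) * ?A) \<le> y (l + k) * ?B"
    using IH nn by (intro mult_left_mono) auto
  ultimately have "x (Suc (l + k)) * ?B \<le> a (Suc (l + k)) * ?B - b (l + k) * ?A"
    unfolding * by (simp add: algebra_simps)
  then show ?case using B by simp
qed

text \<open>The pivot bounds of \<open>cont_step_le\<close> multiply along the path.\<close>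

lemma cont_ge_prod:
  assumes "\<And>i. l \<le> i \<Longrightarrow> i < l + n \<Longrightarrow> 0 \<le> x i \<and> 0 \<le> y i"
    and "n > 0 \<Longrightarrow> x l \<le> a l"
    and "\<And>i. l \<le> i \<Longrightarrow> Suc i < l + n \<Longrightarrow> b i = x i * y i \<and> x (Suc i) + y i \<le> a (Suc i)"
    and "k \<le> n"
  shows "(\<Prod>i=l..<l+k. x i) \<le> cont a b l (Suc k)"
  using \<open>k \<le> n\<close>
proof (induction k)
  case (Suc k)
  have "(\<Prod>i=l..<l+k. x i) * x (l + k) \<le> x (l + k) * cont a b l (Suc k)"
    using Suc assms(1)[of "l + k"] by (auto simp: mult.commute intro: mult_left_mono)
  also have "\<dots> \<le> cont a b l (Suc (Suc k))"
    using cont_step_le[of l n x y a b k] assms Suc.prems by simp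
  finally show ?case by simp
qed simp

subsection \<open>Signed matching sums\<close>

text \<open>The signed multivariate matching polynomial. \<open>V\<close> and \<open>E\<close> are
  separate arguments because the recursions below remove edges and vertices separately.\<close>

definition msum :: "(nat set \<Rightarrow> real) \<Rightarrow> (nat \<Rightarrow> real) \<Rightarrow> nat set \<Rightarrow> nat set set \<Rightarrow> real" where
  "msum w a V E = (\<Sum>M\<in>matchings E. (- 1) ^ card M * (\<Prod>e\<in>M. w e) * (\<Prod>i\<in>V - \<Union>M. a i))"

lemma matchings_empty [simp]: "matchings {} = {{}}"
  by (auto simp: matchings_def)

lemma finite_matchings: "finite E \<Longrightarrow> finite (matchings E)"
  by (rule finite_subset[of _ "Pow E"]) (auto simp: matchings_def)

lemma matchings_insert:
  assumes "e \<notin> E"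
  shows "matchings (insert e E) = matchings E \<union> insert e ` matchings {f \<in> E. disjnt f e}"
proof (intro equalityI subsetI)
  fix M assume M: "M \<in> matchings (insert e E)"
  show "M \<in> matchings E \<union> insert e ` matchings {f \<in> E. disjnt f e}"
  proof (cases "e \<in> M")
    case True
    have "M - {e} \<in> matchings {f \<in> E. disjnt f e}"
      using M True by (auto simp: matchings_def pairwise_def)
    moreover have "M = insert e (M - {e})" using True by auto
    ultimately show ?thesis by blast
  qed (use M in \<open>auto simp: matchings_def\<close>)
next
  fix M assume "M \<in> matchings E \<union> insert e ` matchings {f \<in> E. disjnt f e}"
  then show "M \<in> matchings (insert e E)"
    by (auto simp: matchings_def pairwise_insert disjnt_sym subset_iff)
qed

text \<open>Deletion recurrence: a matching that uses \<open>e\<close> is a matching of the edges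
  disjoint from \<open>e\<close>, with one more sign and the factor \<open>w e\<close>, and the ends
  of \<open>e\<close> are covered.\<close>

lemma msum_insert:
  assumes "finite E" "e \<notin> E"
  shows "msum w a V (insert e E) = msum w a V E - w e * msum w a (V - e) {f \<in> E. disjnt f e}"
proof -
  let ?E = "{f \<in> E. disjnt f e}"
  let ?t = "\<lambda>V M. (- 1) ^ card M * (\<Prod>e\<in>M. w e) * (\<Prod>i\<in>V - \<Union>M. a i)"
  have fin: "finite (matchings E)" "finite (matchings ?E)"
    using assms by (auto intro!: finite_matchings)
  have "msum w a V (insert e E) = msum w a V E + (\<Sum>M\<in>insert e ` matchings ?E. ?t V M)"
    unfolding msum_def matchings_insert[OF assms(2)] using fin assms
    by (intro sum.union_disjoint) (auto simp: matchings_def)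
  also have "(\<Sum>M\<in>insert e ` matchings ?E. ?t V M) = (\<Sum>M\<in>matchings ?E. ?t V (insert e M))"
    using assms by (intro sum.reindex_cong[of "insert e"] inj_onI) (auto simp: matchings_def)
  also have "\<dots> = (\<Sum>M\<in>matchings ?E. - w e * ?t (V - e) M)"
  proof (rule sum.cong[OF refl])
    fix M assume M: "M \<in> matchings ?E"
    then have "finite M" "e \<notin> M"
      using assms by (auto simp: matchings_def dest: finite_subset)
    moreover have "V - \<Union>(insert e M) = V - e - \<Union>M" by auto
    ultimately show "?t V (insert e M) = - w e * ?t (V - e) M"
      by simp
  qed
  also have "\<dots> = - w e * msum w a (V - e) ?E"
    by (simp add: msum_def sum_distrib_left)
  finally show ?thesis by simp
qed

lemma msum_isolated:
  assumes "finite V" "v \<in> V" "v \<notin> \<Union>E"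
  shows "msum w a V E = a v * msum w a (V - {v}) E"
  unfolding msum_def sum_distrib_left
proof (rule sum.cong[OF refl])
  fix M assume "M \<in> matchings E"
  then have "V - \<Union>M = insert v (V - {v} - \<Union>M)"
    using assms by (auto simp: matchings_def)
  then have "(\<Prod>i\<in>V - \<Union>M. a i) = a v * (\<Prod>i\<in>V - {v} - \<Union>M. a i)"
    using assms by simp
  then show "(- 1) ^ card M * (\<Prod>e\<in>M. w e) * (\<Prod>i\<in>V - \<Union>M. a i) =
      a v * ((- 1) ^ card M * (\<Prod>e\<in>M. w e) * (\<Prod>i\<in>V - {v} - \<Union>M. a i))"
    by simp
qed

section \<open>Matching sums of paths and cycles as continuants\<close>

definition path_edges :: "nat \<Rightarrow> nat \<Rightarrow> nat set set" where
  "path_edges l n = (\<lambda>i. {i, Suc i}) ` {i. l \<le> i \<and> Suc i < l + n}"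

lemma finite_path_edges [simp]: "finite (path_edges l n)"
proof -
  have "finite {i. l \<le> i \<and> Suc i < l + n}"
    by (rule finite_subset[of _ "{..l+n}"]) auto
  then show ?thesis by (simp add: path_edges_def)
qed

lemma doubleton_Suc_eq: "{i, Suc i} = {j, Suc j} \<longleftrightarrow> i = j"
  by (auto simp: doubleton_eq_iff)

lemma path_edges_small [simp]: "path_edges l 0 = {}" "path_edges l (Suc 0) = {}"
  by (auto simp: path_edges_def)

lemma path_edges_Suc:
  "path_edges l (Suc (Suc n)) = insert {l + n, Suc (l + n)} (path_edges l (Suc n))"
proof -
  have "{i. l \<le> i \<and> Suc i < l + Suc (Suc n)} = insert (l + n) {i. l \<le> i \<and> Suc i < l + Suc n}"
    by auto
  then show ?thesis by (simp add: path_edges_def)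
qed

text \<open>Deleting the last edge isolates the last vertex; using it leaves the path with two
  vertices fewer. This is the recursion of \<open>cont\<close>.\<close>

lemma msum_path:
  assumes "\<And>i. l \<le> i \<Longrightarrow> Suc i < l + n \<Longrightarrow> w {i, Suc i} = b i"
  shows "msum w a {l..<l+n} (path_edges l n) = cont a b l (Suc n)"
  using assms
proof (induction n rule: induct_nat_012)
  case 0
  then show ?case by (simp add: msum_def)
next
  case 1
  then show ?case by (simp add: msum_def)
next
  case (ge2 n)
  let ?e = "{l + n, Suc (l + n)}"
  have "?e \<notin> path_edges l (Suc n)"
    by (auto simp: path_edges_def doubleton_Suc_eq)
  moreover have "{f \<in> path_edges l (Suc n). disjnt f ?e} = path_edges l n"
    by (auto simp: path_edges_def disjnt_def)
  moreover have "{l..<l + Suc (Suc n)} - ?e = {l..<l+n}" by auto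
  ultimately have "msum w a {l..<l + Suc (Suc n)} (path_edges l (Suc (Suc n))) =
      msum w a {l..<l + Suc (Suc n)} (path_edges l (Suc n)) - w ?e * msum w a {l..<l+n} (path_edges l n)"
    unfolding path_edges_Suc by (subst msum_insert) auto
  also have "msum w a {l..<l + Suc (Suc n)} (path_edges l (Suc n)) =
      a (l + Suc n) * msum w a ({l..<l + Suc (Suc n)} - {l + Suc n}) (path_edges l (Suc n))"
    by (rule msum_isolated) (auto simp: path_edges_def)
  also have "{l..<l + Suc (Suc n)} - {l + Suc n} = {l..<l + Suc n}" by auto
  also have "msum w a {l..<l + Suc n} (path_edges l (Suc n)) = cont a b l (Suc (Suc n))"
    using ge2 by simp
  also have "msum w a {l..<l+n} (path_edges l n) = cont a b l (Suc n)"
    using ge2 by simp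
  also have "w ?e = b (l + n)" using ge2.prems by simp
  finally show ?case by simp
qed

lemma cycle_edges_eq:
  assumes "m \<ge> 3"
  shows "cycle_edges m = insert {0, m - 1} (path_edges 0 m)"
proof (intro equalityI subsetI)
  fix e assume "e \<in> cycle_edges m"
  then obtain i where i: "e = {i, Suc i mod m}" "i < m" by (auto simp: cycle_edges_def)
  show "e \<in> insert {0, m - 1} (path_edges 0 m)"
  proof (cases "Suc i = m")
    case False
    then show ?thesis using i by (auto simp: path_edges_def)
  next
    case True
    then have "i = m - 1" by simp
    then show ?thesis using i True by auto
  qed
next
  fix e assume "e \<in> insert {0, m - 1} (path_edges 0 m)"
  then consider "e = {0, m - 1}" | i where "e = {i, Suc i}" "Suc i < m"
    by (auto simp: path_edges_def)
  then show "e \<in> cycle_edges m"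
  proof cases
    case 1
    then have "e = {m - 1, Suc (m - 1) mod m}" using assms by auto
    then show ?thesis using assms unfolding cycle_edges_def by force
  next
    case 2
    then have "e = {i, Suc i mod m}" "i < m" by auto
    then show ?thesis unfolding cycle_edges_def by blast
  qed
qed

text \<open>Cut at the closing edge: without it the cycle is a path on all vertices; using it leaves
  the path on \<open>1, ..., m - 2\<close>, whose continuant has the shifted index
  \<open>m - 1\<close>.\<close>

lemma msum_cycle:
  assumes "m \<ge> 3" and "\<And>i. i < m \<Longrightarrow> w {i, Suc i mod m} = b i"
  shows "msum w a {..<m} (cycle_edges m) =
    cont a b 0 (Suc m) - b (m - 1) * cont a b 1 (m - 1)"
proof -
  let ?e = "{0, m - 1}"
  obtain k where k: "m = Suc (Suc (Suc k))"
    using assms(1) that[of "m - 3"] by simp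
  have "?e \<notin> path_edges 0 m"
    using k by (auto simp: path_edges_def doubleton_eq_iff)
  moreover have "{f \<in> path_edges 0 m. disjnt f ?e} = path_edges 1 (m - 2)"
    using k by (auto simp: path_edges_def disjnt_def)
  moreover have "{..<m} - ?e = {1..<1 + (m - 2)}" using k by auto
  ultimately have "msum w a {..<m} (cycle_edges m) =
      msum w a {..<m} (path_edges 0 m) - w ?e * msum w a {1..<1 + (m - 2)} (path_edges 1 (m - 2))"
    unfolding cycle_edges_eq[OF assms(1)] by (subst msum_insert) auto
  moreover have "msum w a {0..<0+m} (path_edges 0 m) = cont a b 0 (Suc m)"
  proof (rule msum_path)
    fix i assume "Suc i < 0 + m"
    then show "w {i, Suc i} = b i" using assms(2)[of i] by simp
  qed
  moreover have "msum w a {1..<1 + (m - 2)} (path_edges 1 (m - 2)) = cont a b 1 (Suc (m - 2))"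
  proof (rule msum_path)
    fix i assume "Suc i < 1 + (m - 2)"
    then show "w {i, Suc i} = b i" using assms(2)[of i] by simp
  qed
  moreover have "w ?e = b (m - 1)"
    using assms(2)[of "m - 1"] k by (simp add: insert_commute)
  moreover have "Suc (m - 2) = m - 1" using k by simp
  ultimately show ?thesis by (simp add: atLeast0LessThan)
qed

text \<open>Extends the product bound to subpaths: at a start \<open>j > l\<close>, the condition
  \<open>x j \<le> a j\<close> follows from \<open>x j + y (j - 1) \<le> a j\<close>.\<close>

lemma cont_nonneg:
  assumes nn: "\<And>i. l \<le> i \<Longrightarrow> i < l + n \<Longrightarrow> 0 \<le> x i \<and> 0 \<le> y i"
    and first: "n > 0 \<Longrightarrow> x l \<le> a l"
    and step: "\<And>i. l \<le> i \<Longrightarrow> Suc i < l + n \<Longrightarrow> b i = x i * y i \<and> x (Suc i) + y i \<le> a (Suc i)"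
    and "l \<le> j" "j + k \<le> l + n"
  shows "0 \<le> cont a b j (Suc k)"
proof -
  have "0 \<le> (\<Prod>i=j..<j+k. x i)"
    using assms(4,5) by (intro prod_nonneg) (use nn in force)
  also have "\<dots> \<le> cont a b j (Suc k)"
  proof (rule cont_ge_prod[where n = k and y = y])
    show "x j \<le> a j" if "k > 0"
    proof (cases "j = l")
      case False
      then obtain i where "j = Suc i" "l \<le> i" using assms(4) by (cases j) auto
      then show ?thesis using step[of i] nn[of i] that assms(5) by auto
    qed (use first that assms(5) in auto)
  qed (use nn step assms(4,5) in auto)
  finally show ?thesis .
qed

subsection \<open>Splitting the diagonal along the edges\<close>

text \<open>Eliminating the first vertex subtracts \<^term>\<open>(c l)\<^sup>2 / a l\<close> from the next diagonal entry.  If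
  \<^term>\<open>a l = 0\<close>, then \<^term>\<open>c l = 0\<close>, and division by zero gives the right value.\<close>

lemma path_split:
  assumes "\<And>v. 0 \<le> (\<Sum>i=l..<l+n. a i * (v i)\<^sup>2) + 2 * (\<Sum>i=l..<l+n-1. c i * v i * v (Suc i))"
  shows "\<exists>x y. (\<forall>i. l \<le> i \<and> i < l + n \<longrightarrow> 0 \<le> x i \<and> 0 \<le> y i) \<and> (n > 0 \<longrightarrow> x l \<le> a l) \<and>
    (\<forall>i. l \<le> i \<and> Suc i < l + n \<longrightarrow>
      (c i)\<^sup>2 = x i * y i \<and> x (Suc i) + y i \<le> (a (Suc i) :: real))"
  using assms
proof (induction n arbitrary: l a)
  case 0
  show ?case by (intro exI[of _ "\<lambda>_. 0"]) auto
next
  case (Suc n)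
  show ?case
  proof (cases n)
    case 0
    then have "0 \<le> a l" using Suc.prems[of "\<lambda>_. 1"] by simp
    then show ?thesis using 0 by (intro exI[of _ "\<lambda>_. a l"] exI[of _ "\<lambda>_. 0"]) auto
  next
    case n: (Suc k)
    define t where "t = (c l)\<^sup>2 / a l"
    let ?a' = "a(Suc l := a (Suc l) - t)"
    have form: "0 \<le> a l * (v l)\<^sup>2 + 2 * c l * v l * v (Suc l) + (\<Sum>i=Suc l..<Suc l + n. a i * (v i)\<^sup>2)
        + 2 * (\<Sum>i=Suc l..<Suc l + n - 1. c i * v i * v (Suc i))" for v
    proof -
      have "(\<Sum>i=l..<l + Suc n. a i * (v i)\<^sup>2) = a l * (v l)\<^sup>2 + (\<Sum>i=Suc l..<Suc l + n. a i * (v i)\<^sup>2)"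
        by (subst sum.atLeast_Suc_lessThan) auto
      moreover have "(\<Sum>i=l..<l + Suc n - 1. c i * v i * v (Suc i)) =
          c l * v l * v (Suc l) + (\<Sum>i=Suc l..<Suc l + n - 1. c i * v i * v (Suc i))"
        by (subst sum.atLeast_Suc_lessThan) (auto simp: n)
      ultimately show ?thesis using Suc.prems[of v] by (simp add: algebra_simps)
    qed
    have a0: "0 \<le> a l"
      using form[of "\<lambda>i. if i = l then 1 else 0"] by simp
    have c0: "c l = 0" if "a l = 0"
    proof (rule ccontr)
      assume c: "c l \<noteq> 0"
      \<comment> \<open>With \<open>a l = 0\<close> and the value 1 at \<open>Suc l\<close>, the
        form is linear in the value at \<open>l\<close>, which is chosen to make the form equal to
        -1.\<close>
      define v where "v = (\<lambda>i. if i = l then - (a (Suc l) + 1) / (2 * c l)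
        else if i = Suc l then 1 else 0)"
      have "(\<Sum>i=Suc l..<Suc l + n. a i * (v i)\<^sup>2) = a (Suc l)"
        by (simp add: n v_def sum.atLeast_Suc_lessThan)
      moreover have "(\<Sum>i=Suc l..<Suc l + n - 1. c i * v i * v (Suc i)) = 0"
        by (intro sum.neutral) (auto simp: v_def)
      moreover have "2 * c l * v l * v (Suc l) = - (a (Suc l) + 1)"
        using c by (simp add: v_def)
      ultimately show False using form[of v] that by simp
    qed
    have t: "a l * t = (c l)\<^sup>2" "0 \<le> t"
      using a0 c0 by (auto simp: t_def)
    have "0 \<le> (\<Sum>i=Suc l..<Suc l + n. ?a' i * (v i)\<^sup>2)
        + 2 * (\<Sum>i=Suc l..<Suc l + n - 1. c i * v i * v (Suc i))" for v
    proof -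
      \<comment> \<open>Completing the square: this value at \<open>l\<close> minimizes the form
        when all other values are fixed.\<close>
      define u where "u = v(l := - c l * v (Suc l) / a l)"
      have "a l * (u l)\<^sup>2 + 2 * c l * u l * u (Suc l) = - t * (v (Suc l))\<^sup>2"
        using c0 by (cases "a l = 0") (auto simp: u_def t_def field_simps power2_eq_square)
      moreover have "(\<Sum>i=Suc l..<Suc l + n. a i * (u i)\<^sup>2) =
          t * (v (Suc l))\<^sup>2 + (\<Sum>i=Suc l..<Suc l + n. ?a' i * (v i)\<^sup>2)"
        by (simp add: n u_def sum.atLeast_Suc_lessThan algebra_simps)
      moreover have "(\<Sum>i=Suc l..<Suc l + n - 1. c i * u i * u (Suc i)) =
          (\<Sum>i=Suc l..<Suc l + n - 1. c i * v i * v (Suc i))"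
        by (intro sum.cong) (auto simp: u_def)
      ultimately show ?thesis using form[of u] by simp
    qed
    from Suc.IH[OF this] obtain x y where
      *: "(\<forall>i. Suc l \<le> i \<and> i < Suc l + n \<longrightarrow> 0 \<le> x i \<and> 0 \<le> y i) \<and>
        (n > 0 \<longrightarrow> x (Suc l) \<le> ?a' (Suc l)) \<and>
        (\<forall>i. Suc l \<le> i \<and> Suc i < Suc l + n \<longrightarrow>
          (c i)\<^sup>2 = x i * y i \<and> x (Suc i) + y i \<le> ?a' (Suc i))"
      by (elim exE)
    then have nn: "\<And>i. Suc l \<le> i \<Longrightarrow> i < Suc l + n \<Longrightarrow> 0 \<le> x i \<and> 0 \<le> y i"
      and first: "x (Suc l) \<le> a (Suc l) - t"
      and step: "\<And>i. Suc l \<le> i \<Longrightarrow> Suc i < Suc l + n \<Longrightarrow>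
        (c i)\<^sup>2 = x i * y i \<and> x (Suc i) + y i \<le> a (Suc i)"
      using n by auto
    \<comment> \<open>The first vertex gives all of \<open>a l\<close> to its only edge;
      \<open>t\<close> is the share of that edge at the next vertex.\<close>
    have "(c i)\<^sup>2 = (x(l := a l)) i * (y(l := t)) i \<and> (x(l := a l)) (Suc i) + (y(l := t)) i \<le> a (Suc i)"
      if "l \<le> i" "Suc i < l + Suc n" for i
      using that step[of i] first t by (cases "i = l") auto
    moreover have "0 \<le> (x(l := a l)) i \<and> 0 \<le> (y(l := t)) i" if "l \<le> i" "i < l + Suc n" for i
      using that nn[of i] a0 t by (cases "i = l") auto
    ultimately show ?thesis
      by (intro exI[of _ "x(l := a l)"] exI[of _ "y(l := t)"]) auto
  qed
qed

text \<open>\<open>x i\<close> and \<open>y i\<close> are the shares of the edge from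
  \<open>i\<close> to its successor at these two ends, in this order. They will be the squares of
  the two parameters at that edge.\<close>

definition cycle_split :: "nat \<Rightarrow> (nat \<Rightarrow> real) \<Rightarrow> (nat \<Rightarrow> real) \<Rightarrow> bool" where
  "cycle_split m a c \<longleftrightarrow> (\<exists>x y. \<forall>i<m. 0 \<le> x i \<and> 0 \<le> y i \<and> (c i)\<^sup>2 = x i * y i \<and>
     x (Suc i mod m) + y i \<le> a (Suc i mod m))"

text \<open>The products of the \<open>x i\<close> and of the \<open>y i\<close> are bounded by two
  expressions in which \<open>x (m - 1) * cont a b 0 m\<close> occurs with opposite signs; their sum
  is the right-hand side.\<close>

lemma cycle_split_imp:
  assumes "m \<ge> 2" "cycle_split m a c"
  shows "2 * (\<Prod>i<m. \<bar>c i\<bar>) \<le>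
    cont a (\<lambda>i. (c i)\<^sup>2) 0 (Suc m) - (c (m - 1))\<^sup>2 * cont a (\<lambda>i. (c i)\<^sup>2) 1 (m - 1)"
proof -
  obtain x y where xy: "\<And>i. i < m \<Longrightarrow> 0 \<le> x i \<and> 0 \<le> y i \<and> (c i)\<^sup>2 = x i * y i \<and>
     x (Suc i mod m) + y i \<le> a (Suc i mod m)"
    using assms(2) unfolding cycle_split_def by blast
  obtain k where k: "m = Suc (Suc k)"
    using assms(1) that[of "m - 2"] by simp
  define b where "b = (\<lambda>i. (c i)\<^sup>2)"
  define t where "t = y (m - 1)"
  have t: "0 \<le> t" "x 0 + t \<le> a 0" "b (m - 1) = x (m - 1) * t"
    using xy[of "m - 1"] k by (auto simp: t_def b_def)
  have step: "b i = x i * y i" "x (Suc i) + y i \<le> a (Suc i)" if "Suc i < m" for i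
    using xy[of i] that by (auto simp: b_def)
  have nn: "0 \<le> x i" "0 \<le> y i" and sq: "(c i)\<^sup>2 = x i * y i" if "i < m" for i
    using xy that by blast+
  \<comment> \<open>Paying the share \<open>t\<close> of the closing edge at vertex 0 in advance
    leaves a path.\<close>
  let ?a' = "a(0 := a 0 - t)"
  have "cont ?a' b (Suc 0) j = cont a b (Suc 0) j" "cont ?a' b (Suc (Suc 0)) j = cont a b (Suc (Suc 0)) j" for j
    by (rule cont_cong, simp)+
  then have G: "cont ?a' b 0 m = cont a b 0 m - t * cont a b 1 (m - 1)"
    unfolding k cont_left by (simp add: algebra_simps)
  have "(\<Prod>i=0..<0+Suc k. x i) \<le> cont ?a' b 0 (Suc (Suc k))"
    by (rule cont_ge_prod[where n = m and y = y]) (use nn step t k in auto)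
  then have "(\<Prod>i<m - 1. x i) \<le> cont a b 0 m - t * cont a b 1 (m - 1)"
    using G k by (simp add: atLeast0LessThan)
  then have "x (m - 1) * (\<Prod>i<m - 1. x i) \<le> x (m - 1) * (cont a b 0 m - t * cont a b 1 (m - 1))"
    using nn[of "m - 1"] k by (intro mult_left_mono) auto
  moreover have "(\<Prod>i<m. z i) = z (m - 1) * (\<Prod>i<m - 1. z i)" for z :: "nat \<Rightarrow> real"
    unfolding k by simp
  note last = this
  ultimately have X: "(\<Prod>i<m. x i) \<le> x (m - 1) * (cont a b 0 m - t * cont a b 1 (m - 1))"
    by simp
  \<comment> \<open>The excess in the pivot bound is at least \<open>t\<close> at vertex 0, and each
    step along the path multiplies its lower bound by \<open>y j\<close>.\<close>
  have "t * (\<Prod>i<j. y i) \<le> cont a b 0 (Suc (Suc j)) - x j * cont a b 0 (Suc j)" if "j < m" for j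
    using that
  proof (induction j)
    case 0
    then show ?case using t by simp
  next
    case (Suc j)
    have "0 \<le> cont a b 0 (Suc (Suc j))"
      by (rule cont_nonneg[where l = 0 and n = m and x = x and y = y]) (use nn step t Suc.prems in auto)
    then have "(x (Suc j) + y j) * cont a b 0 (Suc (Suc j)) \<le> a (Suc j) * cont a b 0 (Suc (Suc j))"
      using step Suc.prems by (intro mult_right_mono) auto
    moreover have "y j * (t * (\<Prod>i<j. y i)) \<le> y j * (cont a b 0 (Suc (Suc j)) - x j * cont a b 0 (Suc j))"
      using Suc nn by (intro mult_left_mono) auto
    ultimately show ?case
      using step[of j] Suc.prems by (simp add: algebra_simps)
  qed
  from this[of "m - 1"] have Y: "(\<Prod>i<m. y i) \<le> cont a b 0 (Suc m) - x (m - 1) * cont a b 0 m"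
    using k last[of y] by (simp add: t_def mult.commute mult.left_commute del: cont.simps prod.lessThan_Suc)
  let ?X = "\<Prod>i<m. x i" and ?Y = "\<Prod>i<m. y i"
  have "(\<Prod>i<m. \<bar>c i\<bar>)\<^sup>2 = (\<Prod>i<m. (c i)\<^sup>2)"
    by (simp add: prod_power_distrib)
  also have "\<dots> = ?X * ?Y"
    unfolding prod.distrib[symmetric] by (intro prod.cong refl) (simp only: sq lessThan_iff)
  finally have "(2 * (\<Prod>i<m. \<bar>c i\<bar>))\<^sup>2 = 4 * (?X * ?Y)"
    by (simp only: power_mult_distrib) simp
  also have "\<dots> \<le> (?X + ?Y)\<^sup>2"
    using zero_le_power2[of "?X - ?Y"] by (simp add: power2_eq_square algebra_simps)
  finally have "2 * (\<Prod>i<m. \<bar>c i\<bar>) \<le> ?X + ?Y"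
    by (rule power2_le_imp_le) (intro add_nonneg_nonneg prod_nonneg; simp add: nn)
  also have "\<dots> \<le> cont a b 0 (Suc m) - x (m - 1) * t * cont a b 1 (m - 1)"
    using X Y by (simp only: right_diff_distrib mult.assoc)
  finally show ?thesis unfolding t(3)[symmetric] unfolding b_def .
qed

text \<open>A zero edge opens the cycle into the path \<open>Suc r, ..., r + m\<close>, read modulo
  \<open>m\<close>, to which \<open>path_split\<close> applies.\<close>

lemma cycle_split_zero_edge:
  assumes form: "\<And>v. 0 \<le> (\<Sum>i<m. a i * (v i)\<^sup>2) + 2 * (\<Sum>i<m. c i * v i * v (Suc i mod m))"
    and r: "r < m" "c r = 0"
  shows "cycle_split m a c"
proof -
  define lift where "lift = (\<lambda>j. if j \<le> r then j + m else j)"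
  have bij: "bij_betw lift {..<m} {Suc r..<Suc r + m}"
    by (rule bij_betw_byWitness[where f' = "\<lambda>i. if i < m then i else i - m"])
      (use r in \<open>auto simp: lift_def\<close>)
  have lift_mod: "lift j mod m = j" if "j < m" for j
    using that by (auto simp: lift_def)
  have lift_suc: "lift (Suc j mod m) = Suc (lift j)" if "j < m" "j \<noteq> r" for j
    using that r by (auto simp: lift_def mod_Suc)
  have lift_range: "Suc r \<le> lift j" "lift j < Suc r + m" if "j < m" for j
    using that r by (auto simp: lift_def)
  have lift_top: "Suc (lift j) < Suc r + m" if "j < m" "j \<noteq> r" for j
    using that r by (auto simp: lift_def)
  have "0 \<le> (\<Sum>i=Suc r..<Suc r + m. a (i mod m) * (v i)\<^sup>2)
      + 2 * (\<Sum>i=Suc r..<Suc r + m - 1. c (i mod m) * v i * v (Suc i))" for v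
  proof -
    have "(\<Sum>i=Suc r..<Suc r + m. a (i mod m) * (v i)\<^sup>2) = (\<Sum>j<m. a j * (v (lift j))\<^sup>2)"
      unfolding sum.reindex_bij_betw[OF bij, symmetric] by (intro sum.cong) (auto simp: lift_mod)
    \<comment> \<open>The added term \<open>i = r + m\<close> belongs to the zero edge
      \<open>r\<close>.\<close>
    moreover have "(\<Sum>i=Suc r..<Suc r + m - 1. c (i mod m) * v i * v (Suc i)) =
        (\<Sum>i=Suc r..<Suc r + m. c (i mod m) * v i * v (Suc i))"
    proof (rule sum.mono_neutral_left)
      show "\<forall>i\<in>{Suc r..<Suc r + m} - {Suc r..<Suc r + m - 1}. c (i mod m) * v i * v (Suc i) = 0"
      proof
        fix i assume "i \<in> {Suc r..<Suc r + m} - {Suc r..<Suc r + m - 1}"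
        then have "i = r + m" by auto
        then show "c (i mod m) * v i * v (Suc i) = 0" using r by simp
      qed
    qed auto
    moreover have "\<dots> = (\<Sum>j<m. c j * v (lift j) * v (lift (Suc j mod m)))"
      unfolding sum.reindex_bij_betw[OF bij, symmetric]
    proof (intro sum.cong refl)
      fix j assume "j \<in> {..<m}"
      then show "c (lift j mod m) * v (lift j) * v (Suc (lift j)) =
          c j * v (lift j) * v (lift (Suc j mod m))"
        using r by (cases "j = r") (auto simp: lift_mod lift_suc)
    qed
    ultimately show ?thesis using form[of "\<lambda>j. v (lift j)"] by simp
  qed
  from path_split[OF this] obtain x y where xy:
    "(\<forall>i. Suc r \<le> i \<and> i < Suc r + m \<longrightarrow> 0 \<le> x i \<and> 0 \<le> y i) \<and>
     (m > 0 \<longrightarrow> x (Suc r) \<le> a (Suc r mod m)) \<and>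
     (\<forall>i. Suc r \<le> i \<and> Suc i < Suc r + m \<longrightarrow>
       (c (i mod m))\<^sup>2 = x i * y i \<and> x (Suc i) + y i \<le> a (Suc i mod m))"
    by (elim exE)
  then have nn: "Suc r \<le> i \<Longrightarrow> i < Suc r + m \<Longrightarrow> 0 \<le> x i \<and> 0 \<le> y i"
    and first: "m > 0 \<Longrightarrow> x (Suc r) \<le> a (Suc r mod m)"
    and step: "Suc r \<le> i \<Longrightarrow> Suc i < Suc r + m \<Longrightarrow>
      (c (i mod m))\<^sup>2 = x i * y i \<and> x (Suc i) + y i \<le> a (Suc i mod m)" for i
    by blast+
  \<comment> \<open>With \<open>y\<close> set to 0 at edge \<open>r\<close>, the bound at the
    successor of \<open>r\<close> is the start condition of the path.\<close>
  let ?x = "\<lambda>j. x (lift j)" and ?y = "\<lambda>j. if j = r then 0 else y (lift j)"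
  have "0 \<le> ?x j \<and> 0 \<le> ?y j \<and> (c j)\<^sup>2 = ?x j * ?y j \<and> ?x (Suc j mod m) + ?y j \<le> a (Suc j mod m)"
    if "j < m" for j
  proof (cases "j = r")
    case True
    have "lift (Suc r mod m) = Suc r"
      using r by (auto simp: lift_def mod_Suc)
    moreover have "0 \<le> x (lift r)" "x (Suc r) \<le> a (Suc r mod m)"
      using nn[OF lift_range[OF r(1)]] first r(1) by simp_all
    ultimately show ?thesis using True r by simp
  next
    case False
    have "Suc (lift j) mod m = Suc j mod m"
      using lift_mod[OF that] by (metis mod_Suc_eq)
    moreover have "(c (lift j mod m))\<^sup>2 = x (lift j) * y (lift j) \<and>
        x (Suc (lift j)) + y (lift j) \<le> a (Suc (lift j) mod m)"
      by (rule step[OF lift_range(1)[OF that] lift_top[OF that False]])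
    moreover have "0 \<le> x (lift j) \<and> 0 \<le> y (lift j)"
      by (rule nn[OF lift_range[OF that]])
    ultimately show ?thesis
      using lift_suc[OF that False] lift_mod[OF that] False by simp
  qed
  then show ?thesis unfolding cycle_split_def
    by (intro exI[of _ ?x] exI[of _ ?y] allI impI)
qed

text \<open>With all edges nonzero, let \<open>T\<close> be the matrix with diagonal \<open>a\<close> and entries \<open>- \<bar>c i\<bar>\<close> at the
  edges.  The vector \<open>v\<close> below is, up to scaling, the solution of \<open>T v = t e\<^sub>0\<close> given by
  Cramer's rule, so that \<open>(T v)\<^sub>0 = det T\<close>.  A positive \<open>v\<close> with \<open>T v \<ge> 0\<close> splits the
  diagonal through \<open>x i = \<bar>c i\<bar> v (i + 1) / v i\<close> and \<open>y i = \<bar>c i\<bar> v i / v (i + 1)\<close>.\<close>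

lemma cycle_split_nonzero_edges:
  assumes "m \<ge> 3"
    and form: "\<And>v. 0 \<le> (\<Sum>i<m. a i * (v i)\<^sup>2) + 2 * (\<Sum>i<m. c i * v i * v (Suc i mod m))"
    and nz: "\<And>i. i < m \<Longrightarrow> c i \<noteq> 0"
    and ineq: "2 * (\<Prod>i<m. \<bar>c i\<bar>) \<le>
      cont a (\<lambda>i. (c i)\<^sup>2) 0 (Suc m) - (c (m - 1))\<^sup>2 * cont a (\<lambda>i. (c i)\<^sup>2) 1 (m - 1)"
  shows "cycle_split m a c"
proof -
  define b where "b = (\<lambda>i. (c i)\<^sup>2)"
  define d where "d = (\<lambda>i. \<bar>c i\<bar>)"
  \<comment> \<open>\<open>L i\<close> belongs to the path \<open>1, ..., i - 1\<close> and
    \<open>R i\<close> to the path \<open>i + 1, ..., m - 1\<close>.\<close>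
  define L where "L = (\<lambda>i. cont a b 1 i)"
  define R where "R = (\<lambda>i. cont a b (Suc i) (m - i))"
  have d: "d i > 0" if "i < m" for i using nz that by (simp add: d_def)
  have b: "b i = d i * d i" for i by (simp add: b_def d_def power2_eq_square)

  \<comment> \<open>Setting the value at vertex 0 to zero restricts the form to a path, whose
    splitting makes all continuants of its subpaths nonnegative.\<close>
  have "0 \<le> (\<Sum>i=1..<1 + (m - 1). a i * (v i)\<^sup>2) + 2 * (\<Sum>i=1..<1 + (m - 1) - 1. c i * v i * v (Suc i))" for v
  proof -
    let ?u = "v(0 := 0)"
    have "(\<Sum>i<m. a i * (?u i)\<^sup>2) = (\<Sum>i=1..<1 + (m - 1). a i * (v i)\<^sup>2)"
      by (rule sum.mono_neutral_cong_right) auto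
    moreover have "(\<Sum>i<m. c i * ?u i * ?u (Suc i mod m)) = (\<Sum>i=1..<1 + (m - 1) - 1. c i * v i * v (Suc i))"
      by (rule sum.mono_neutral_cong_right) (use assms(1) in \<open>auto simp: mod_Suc\<close>)
    ultimately show ?thesis using form[of ?u] by simp
  qed
  from path_split[OF this] obtain x y where xy:
    "(\<forall>i. 1 \<le> i \<and> i < 1 + (m - 1) \<longrightarrow> 0 \<le> x i \<and> 0 \<le> y i) \<and> (m - 1 > 0 \<longrightarrow> x 1 \<le> a 1) \<and>
     (\<forall>i. 1 \<le> i \<and> Suc i < 1 + (m - 1) \<longrightarrow>
       (c i)\<^sup>2 = x i * y i \<and> x (Suc i) + y i \<le> a (Suc i))"
    by (elim exE)
  have K0: "0 \<le> cont a b j (Suc k)" if "1 \<le> j" "j + k \<le> m" for j k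
    by (rule cont_nonneg[where l = 1 and n = "m - 1" and x = x and y = y])
      (use xy that assms(1) in \<open>auto simp: b_def\<close>)
  have L0: "0 \<le> L i" if "i \<le> m" for i
    using K0[of 1 "i - 1"] that by (cases i) (auto simp: L_def)
  have R0: "0 \<le> R i" if "i \<le> m" for i
  proof (cases "i = m")
    case False
    then have "m - i = Suc (m - Suc i)" using that by simp
    then show ?thesis using K0[of "Suc i" "m - Suc i"] that False by (simp add: R_def)
  qed (simp add: R_def)
  have L_rec: "L (Suc i) = a i * L i - b (i - 1) * L (i - 1)" if "1 \<le> i" for i
    using that by (cases i) (auto simp: L_def)
  have R_rec: "R (i - 1) = a i * R i - b i * R (Suc i)" if "1 \<le> i" "i < m" for i
  proof -
    have *: "m - (i - 1) = Suc (Suc (m - Suc i))" "m - i = Suc (m - Suc i)" "Suc (i - 1) = i"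
      using that by auto
    show ?thesis unfolding R_def * by (rule cont_left)
  qed
  have ends: "L 0 = 0" "L 1 = 1" "R m = 0" "R (m - 1) = 1" "R 0 = L m"
    using assms(1) by (auto simp: L_def R_def)

  \<comment> \<open>The hypothesis expanded at vertex 0; the difference of the two sides is
    \<open>det T\<close>.\<close>
  have mu: "2 * (\<Prod>i<m. d i) \<le> a 0 * L m - b 0 * R 1 - b (m - 1) * L (m - 1)"
  proof -
    have *: "Suc m = Suc (Suc (m - 1))" using assms(1) by simp
    have "cont a b 0 (Suc m) = a 0 * cont a b (Suc 0) (Suc (m - 1)) - b 0 * cont a b (Suc (Suc 0)) (m - 1)"
      unfolding * by (rule cont_left)
    then show ?thesis using ineq assms(1) by (simp add: b_def d_def L_def R_def)
  qed
  have "L m > 0"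
  proof (rule ccontr)
    assume "\<not> L m > 0"
    then have "L m = 0" using L0[of m] by simp
    moreover have "0 \<le> b 0 * R 1" "0 \<le> b (m - 1) * L (m - 1)"
      using R0[of 1] L0[of "m - 1"] assms(1) by (auto simp: b_def)
    moreover have "0 < (\<Prod>i<m. d i)" using d by (intro prod_pos) auto
    ultimately show False using mu by simp
  qed
  have L_pos: "L i > 0" if "1 \<le> i" "i \<le> m" for i
  proof (rule ccontr)
    assume "\<not> L i > 0"
    then have "L i = 0" using L0[of i] that by simp
    \<comment> \<open>A zero propagates: if \<open>L j = 0\<close>, the recursion gives
      \<open>L (Suc j) \<le> 0\<close>.\<close>
    have "L m = 0"
      using \<open>i \<le> m\<close>
    proof (induction rule: dec_induct)
      case (step j)
      have "0 \<le> b (j - 1) * L (j - 1)"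
        using L0[of "j - 1"] step by (auto simp: b_def)
      then show ?case
        using L_rec[of j] L0[of "Suc j"] step that(1) by auto
    qed (rule \<open>L i = 0\<close>)
    then show False using \<open>L m > 0\<close> by simp
  qed

  \<comment> \<open>The summands belong to the two ways around the cycle from vertex 0 to
    \<open>i\<close>. Index \<open>m\<close> stands for vertex 0 again.\<close>
  define v where "v = (\<lambda>i. (\<Prod>k<i. d k) * R i + (\<Prod>k=i..<m. d k) * L i)"
  have v0: "v 0 = L m" "v m = L m" using ends by (simp_all add: v_def)
  have v_pos: "v i > 0" if "i \<le> m" for i
  proof (cases "i = 0")
    case False
    have "0 \<le> (\<Prod>k<i. d k) * R i"
      using R0 that d by (intro mult_nonneg_nonneg prod_nonneg) (auto intro: less_imp_le)
    moreover have "0 < (\<Prod>k=i..<m. d k) * L i"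
      using L_pos[of i] False that d by (intro mult_pos_pos prod_pos) auto
    ultimately show ?thesis by (simp add: v_def)
  qed (use v0 \<open>L m > 0\<close> in simp)
  \<comment> \<open>Row \<open>i\<close> of \<open>T v = 0\<close> away from vertex 0; each summand
    of \<open>v\<close> satisfies it by its own recursion.\<close>
  have inner: "d (i - 1) * v (i - 1) + d i * v (Suc i) = a i * v i" if "1 \<le> i" "i < m" for i
  proof -
    define P where "P = (\<Prod>k<i - 1. d k)"
    define Q where "Q = (\<Prod>k=Suc i..<m. d k)"
    have P: "(\<Prod>k<i. d k) = P * d (i - 1)" "(\<Prod>k<Suc i. d k) = P * d (i - 1) * d i"
      using that by (cases i; simp add: P_def)+
    have Q: "(\<Prod>k=i..<m. d k) = d i * Q" "(\<Prod>k=i - 1..<m. d k) = d (i - 1) * d i * Q"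
      using that by (cases i; simp add: Q_def prod.atLeast_Suc_lessThan)+
    show ?thesis
      unfolding v_def P Q L_rec[OF that(1)] R_rec[OF that] b
      unfolding P_def[symmetric] Q_def[symmetric] by (simp add: algebra_simps)
  qed
  have outer: "d (m - 1) * v (m - 1) + d 0 * v 1 \<le> a 0 * v 0"
  proof -
    have "d 0 * (\<Prod>k=1..<m. d k) = (\<Prod>k<m. d k)"
      using assms(1) by (simp add: prod.atLeast_Suc_lessThan[of 0 m] flip: atLeast0LessThan)
    then have 1: "d 0 * v 1 = b 0 * R 1 + (\<Prod>k<m. d k)"
      using ends by (simp add: v_def b algebra_simps)
    have "{..<m} = insert (m - 1) {..<m - 1}" "{m - 1..<m} = {m - 1}" using assms(1) by auto
    then have 2: "d (m - 1) * v (m - 1) = b (m - 1) * L (m - 1) + (\<Prod>k<m. d k)"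
      using ends by (simp add: v_def b algebra_simps)
    show ?thesis using mu v0 1 2 by simp
  qed
  define x' y' where "x' = (\<lambda>i. d i * v (Suc i) / v i)" and "y' = (\<lambda>i. d i * v i / v (Suc i))"
  have "0 \<le> x' i \<and> 0 \<le> y' i \<and> (c i)\<^sup>2 = x' i * y' i \<and> x' (Suc i mod m) + y' i \<le> a (Suc i mod m)"
    if i: "i < m" for i
  proof (intro conjI)
    have pos: "v i > 0" "v (Suc i) > 0" "d i > 0" using v_pos d i by auto
    then show "0 \<le> x' i" "0 \<le> y' i" "(c i)\<^sup>2 = x' i * y' i"
      by (auto simp: x'_def y'_def b[unfolded b_def])
    have "d (Suc i mod m) * v (Suc (Suc i mod m)) + d i * v i \<le> a (Suc i mod m) * v (Suc i mod m)"
    proof (cases "Suc i = m")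
      case True
      then have "i = m - 1" by simp
      then show ?thesis using True outer by (simp add: algebra_simps)
    next
      case False
      then show ?thesis using inner[of "Suc i"] i by simp
    qed
    moreover have "v (Suc i) = v (Suc i mod m)"
      using v0 i by (cases "Suc i = m") auto
    ultimately show "x' (Suc i mod m) + y' i \<le> a (Suc i mod m)"
      using pos by (simp add: x'_def y'_def field_simps)
  qed
  then show ?thesis unfolding cycle_split_def by blast
qed

subsection \<open>Matrices supported on the cycle\<close>

lemma psd_graph_sym:
  assumes "S \<in> psd_graph m E" "i < m" "j < m"
  shows "S $$ (i, j) = S $$ (j, i)"
proof -
  have S: "S \<in> carrier_mat m m" "transpose_mat S = S"
    using assms(1) by (auto simp: psd_graph_def psd_def)
  have "S $$ (i, j) = transpose_mat S $$ (i, j)" by (simp only: S)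
  also have "\<dots> = S $$ (j, i)" using S(1) assms by simp
  finally show ?thesis .
qed

section \<open>Cyclic successors, faces of the cycle and entries of \<open>phi\<close>\<close>

context
  fixes m :: nat
  assumes m: "m \<ge> 3"
begin

text \<open>The third claim, which fails for \<open>m = 2\<close>, says that the two neighbours of a
  vertex differ.\<close>

lemma suc_mod:
  assumes "i < m"
  shows "Suc i mod m < m" "Suc i mod m \<noteq> i" "Suc (Suc i mod m) mod m \<noteq> i"
  using assms m by (auto simp: mod_Suc)

lemma suc_mod_inject: "i < m \<Longrightarrow> j < m \<Longrightarrow> Suc i mod m = Suc j mod m \<longleftrightarrow> i = j"
  using m by (auto simp: mod_Suc)

lemma suc_mod_surj:
  assumes "i < m"
  obtains j where "j < m" "i = Suc j mod m"
proof (cases i)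
  case 0
  show ?thesis using that[of "m - 1"] m 0 by simp
next
  case (Suc j)
  show ?thesis using that[of j] Suc assms by simp
qed

lemma suc_mod_bij: "bij_betw (\<lambda>i. Suc i mod m) {..<m} {..<m}"
  unfolding bij_betw_def
proof
  show inj: "inj_on (\<lambda>i. Suc i mod m) {..<m}"
    by (rule inj_onI) (simp only: lessThan_iff suc_mod_inject)
  show "(\<lambda>i. Suc i mod m) ` {..<m} = {..<m}"
    by (rule endo_inj_surj[OF _ _ inj]) (use suc_mod(1) in blast)+
qed

lemma faces_cases:
  assumes "F \<in> complex_of_facets (cycle_edges m)" "F \<noteq> {}"
  obtains i where "i < m" "F = {i}" | i where "i < m" "F = {i, Suc i mod m}"
proof -
  obtain i where i: "i < m" "F \<subseteq> {i, Suc i mod m}"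
    using assms by (auto simp: complex_of_facets_def cycle_edges_def)
  then have "F = {i} \<or> F = {Suc i mod m} \<or> F = {i, Suc i mod m}"
    using assms(2) by auto
  then show thesis using that suc_mod(1)[OF i(1)] i(1) by metis
qed

lemma finite_faces: "finite (complex_of_facets (cycle_edges m))"
proof (rule finite_subset)
  show "complex_of_facets (cycle_edges m) \<subseteq> Pow {..<m}"
  proof
    fix F assume "F \<in> complex_of_facets (cycle_edges m)"
    then obtain i where "i < m" "F \<subseteq> {i, Suc i mod m}"
      by (auto simp: complex_of_facets_def cycle_edges_def)
    then show "F \<in> Pow {..<m}" using suc_mod(1)[of i] by auto
  qed
qed simp

lemma phi_off_diagonal:
  assumes "i < m" "j < m" "i \<noteq> j"
  shows "phi m (complex_of_facets (cycle_edges m)) \<gamma> $$ (i, j) =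
    (if {i, j} \<in> cycle_edges m then \<gamma> i {i, j} * \<gamma> j {i, j} else 0)"
proof -
  let ?D = "complex_of_facets (cycle_edges m)"
  have edge: "F = {i, j} \<and> {i, j} \<in> cycle_edges m" if "F \<in> ?D" "i \<in> F" "j \<in> F" for F
  proof -
    have "F \<noteq> {}" using that by auto
    with that(1) show ?thesis
      by (cases rule: faces_cases) (use that assms in \<open>auto simp: cycle_edges_def\<close>)
  qed
  have "(\<Sum>F\<in>?D. Gam \<gamma> i F * Gam \<gamma> j F) =
      (\<Sum>F\<in>(if {i, j} \<in> cycle_edges m then {{i, j}} else {}). \<gamma> i F * \<gamma> j F)"
    by (rule sum.mono_neutral_cong_right[OF finite_faces])
      (use edge in \<open>auto simp: Gam_def complex_of_facets_def split: if_splits\<close>)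
  then show ?thesis using assms by (simp add: phi_def)
qed

text \<open>The faces containing \<open>j\<close> are its singleton and its two edges. Writing
  \<open>j\<close> as a successor names both edges without a predecessor function.\<close>

lemma phi_diagonal:
  assumes i: "i < m" and j: "j = Suc i mod m"
  shows "phi m (complex_of_facets (cycle_edges m)) \<gamma> $$ (j, j) =
    (\<gamma> j {j})\<^sup>2 + (\<gamma> j {i, j})\<^sup>2 + (\<gamma> j {j, Suc j mod m})\<^sup>2"
proof -
  let ?D = "complex_of_facets (cycle_edges m)" and ?T = "{{j}, {i, j}, {j, Suc j mod m}}"
  have jm: "j < m" and ne: "i \<noteq> j" "Suc j mod m \<noteq> j" "Suc j mod m \<noteq> i"
    using suc_mod[of i] suc_mod[of j] assms by auto
  have star: "F \<in> ?T" if "F \<in> ?D" "j \<in> F" for F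
  proof -
    have "F \<noteq> {}" using that by auto
    with that(1) show ?thesis
    proof (cases rule: faces_cases)
      case (2 k)
      then have "k = j \<or> k = i"
        using that(2) i by (auto simp: j suc_mod_inject)
      then show ?thesis using 2 j by auto
    qed (use that in auto)
  qed
  have "?T \<subseteq> ?D"
    using i jm j unfolding complex_of_facets_def cycle_edges_def by blast
  then have "(\<Sum>F\<in>?D. Gam \<gamma> j F * Gam \<gamma> j F) = (\<Sum>F\<in>?T. (\<gamma> j F)\<^sup>2)"
    by (intro sum.mono_neutral_cong_right[OF finite_faces])
      (use star in \<open>auto simp: Gam_def power2_eq_square\<close>)
  also have "\<dots> = (\<gamma> j {j})\<^sup>2 + (\<gamma> j {i, j})\<^sup>2 + (\<gamma> j {j, Suc j mod m})\<^sup>2"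
    using ne by (simp add: doubleton_eq_iff)
  finally show ?thesis using jm by (simp add: phi_def)
qed

lemma psd_graph_cycle_form:
  assumes S: "S \<in> psd_graph m (cycle_edges m)"
  shows "0 \<le> (\<Sum>i<m. S $$ (i, i) * (v i)\<^sup>2) + 2 * (\<Sum>i<m. S $$ (i, Suc i mod m) * v i * v (Suc i mod m))"
proof -
  let ?s = "\<lambda>i. Suc i mod m" and ?V = "vec m v"
  have S': "S \<in> carrier_mat m m" "0 \<le> ?V \<bullet> (S *\<^sub>v ?V)"
    "\<And>i j. i < m \<Longrightarrow> j < m \<Longrightarrow> i \<noteq> j \<Longrightarrow> {i, j} \<notin> cycle_edges m \<Longrightarrow> S $$ (i, j) = 0"
    using S by (auto simp: psd_graph_def psd_def)
  note sym = psd_graph_sym[OF S]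
  \<comment> \<open>Rows are indexed by successors so that \<open>i\<close> is the predecessor;
    rotating the sum later makes the two edge sums coincide.\<close>
  have row: "(\<Sum>j<m. S $$ (?s i, j) * v j) =
      S $$ (i, ?s i) * v i + S $$ (?s i, ?s i) * v (?s i) + S $$ (?s i, ?s (?s i)) * v (?s (?s i))"
    if i: "i < m" for i
  proof -
    define j k where jk: "j = ?s i" "k = ?s j"
    have j: "j < m" "i \<noteq> j" using suc_mod[OF i] by (metis jk(1))+
    have k: "k < m" "j \<noteq> k" "i \<noteq> k"
      using suc_mod(1,2)[OF j(1)] suc_mod(3)[OF i] by (metis jk)+
    have "S $$ (j, l) = 0" if "l < m" "l \<notin> {i, j, k}" for l
    proof (rule S'(3))
      show "{j, l} \<notin> cycle_edges m"
      proof
        assume "{j, l} \<in> cycle_edges m"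
        then obtain h where "h < m" "{j, l} = {h, ?s h}" by (auto simp: cycle_edges_def)
        then have "j = h \<and> l = k \<or> ?s i = ?s h \<and> l = h"
          unfolding jk by (metis doubleton_eq_iff)
        then show False using that \<open>h < m\<close> i suc_mod_inject by blast
      qed
    qed (use that j in auto)
    then have "(\<Sum>l<m. S $$ (j, l) * v l) = (\<Sum>l\<in>{i, j, k}. S $$ (j, l) * v l)"
      using i j k by (intro sum.mono_neutral_right) auto
    also have "\<dots> = S $$ (i, j) * v i + S $$ (j, j) * v j + S $$ (j, k) * v k"
      using j k sym[OF i j(1)] by simp
    finally show ?thesis unfolding jk .
  qed
  have "?V \<bullet> (S *\<^sub>v ?V) = (\<Sum>i<m. v i * (\<Sum>j<m. S $$ (i, j) * v j))"
    using S'(1) by (auto simp: scalar_prod_def atLeast0LessThan intro!: sum.cong)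
  also have "\<dots> = (\<Sum>i<m. v (?s i) * (\<Sum>j<m. S $$ (?s i, j) * v j))"
    by (rule sum.reindex_bij_betw[OF suc_mod_bij, symmetric])
  also have "\<dots> = (\<Sum>i<m. S $$ (i, ?s i) * v i * v (?s i))
      + (\<Sum>i<m. S $$ (?s i, ?s i) * (v (?s i))\<^sup>2)
      + (\<Sum>i<m. S $$ (?s i, ?s (?s i)) * v (?s i) * v (?s (?s i)))"
    unfolding sum.distrib[symmetric]
    by (intro sum.cong refl) (simp only: lessThan_iff row, simp add: algebra_simps power2_eq_square)
  also have "(\<Sum>i<m. S $$ (?s i, ?s i) * (v (?s i))\<^sup>2) = (\<Sum>i<m. S $$ (i, i) * (v i)\<^sup>2)"
    by (rule sum.reindex_bij_betw[OF suc_mod_bij])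
  also have "(\<Sum>i<m. S $$ (?s i, ?s (?s i)) * v (?s i) * v (?s (?s i))) =
      (\<Sum>i<m. S $$ (i, ?s i) * v i * v (?s i))"
    by (rule sum.reindex_bij_betw[OF suc_mod_bij])
  finally show ?thesis using S'(2) by simp
qed

text \<open>The shares are the squares of the edge parameters, and the slack on the diagonal is the
  square of the singleton parameter.\<close>

lemma phi_range_iff_cycle_split:
  assumes S: "S \<in> psd_graph m (cycle_edges m)"
  shows "S \<in> range (phi m (complex_of_facets (cycle_edges m))) \<longleftrightarrow>
    cycle_split m (\<lambda>i. S $$ (i, i)) (\<lambda>i. S $$ (i, Suc i mod m))"
proof
  let ?s = "\<lambda>i. Suc i mod m"
  assume "S \<in> range (phi m (complex_of_facets (cycle_edges m)))"
  then obtain \<gamma> where \<gamma>: "S = phi m (complex_of_facets (cycle_edges m)) \<gamma>" by blast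
  define x y where "x = (\<lambda>i. (\<gamma> i {i, ?s i})\<^sup>2)" and "y = (\<lambda>i. (\<gamma> (?s i) {i, ?s i})\<^sup>2)"
  have "(S $$ (i, ?s i))\<^sup>2 = x i * y i \<and> x (?s i) + y i \<le> S $$ (?s i, ?s i)" if "i < m" for i
  proof
    have "{i, ?s i} \<in> cycle_edges m" using that by (auto simp: cycle_edges_def)
    then have "S $$ (i, ?s i) = \<gamma> i {i, ?s i} * \<gamma> (?s i) {i, ?s i}"
      using phi_off_diagonal[of i "?s i"] suc_mod[OF that] that by (simp add: \<gamma>)
    then show "(S $$ (i, ?s i))\<^sup>2 = x i * y i"
      by (simp add: x_def y_def power_mult_distrib)
    show "x (?s i) + y i \<le> S $$ (?s i, ?s i)"
      unfolding \<gamma> phi_diagonal[OF that refl] by (simp add: x_def y_def)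
  qed
  moreover have "0 \<le> x i" "0 \<le> y i" for i by (simp_all add: x_def y_def)
  ultimately show "cycle_split m (\<lambda>i. S $$ (i, i)) (\<lambda>i. S $$ (i, ?s i))"
    unfolding cycle_split_def by blast
next
  let ?s = "\<lambda>i. Suc i mod m"
  assume "cycle_split m (\<lambda>i. S $$ (i, i)) (\<lambda>i. S $$ (i, ?s i))"
  then obtain x y where xy: "\<And>i. i < m \<Longrightarrow> 0 \<le> x i \<and> 0 \<le> y i \<and> (S $$ (i, ?s i))\<^sup>2 = x i * y i \<and>
      x (?s i) + y i \<le> S $$ (?s i, ?s i)"
    unfolding cycle_split_def by blast
  have S': "S \<in> carrier_mat m m"
    "\<And>i j. i < m \<Longrightarrow> j < m \<Longrightarrow> i \<noteq> j \<Longrightarrow> {i, j} \<notin> cycle_edges m \<Longrightarrow> S $$ (i, j) = 0"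
    using S by (auto simp: psd_graph_def psd_def)
  note sym = psd_graph_sym[OF S]
  define p where "p = inv_into {..<m} ?s"
  have p: "p (?s i) = i" if "i < m" for i
    using that suc_mod_bij unfolding p_def bij_betw_def by (auto intro: inv_into_f_f)
  \<comment> \<open>The parameter at the head of an edge carries the sign of the matrix entry;
    \<open>p i\<close> is the predecessor of \<open>i\<close>.\<close>
  define \<gamma> where "\<gamma> = (\<lambda>i F. if F = {i} then sqrt (S $$ (i, i) - x i - y (p i))
    else if F = {i, ?s i} then sqrt (x i) else (if S $$ (p i, i) < 0 then - 1 else 1) * sqrt (y (p i)))"
  have tail: "\<gamma> i {i, ?s i} = sqrt (x i)" if "i < m" for i
    using suc_mod[OF that] by (simp add: \<gamma>_def)
  have head: "\<gamma> (?s i) {i, ?s i} = (if S $$ (i, ?s i) < 0 then - 1 else 1) * sqrt (y i)" if "i < m" for i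
    using suc_mod[OF that] p[OF that] by (simp add: \<gamma>_def doubleton_eq_iff)
  have edge: "\<gamma> i {i, ?s i} * \<gamma> (?s i) {i, ?s i} = S $$ (i, ?s i)" if "i < m" for i
  proof -
    have "sqrt (x i) * sqrt (y i) = \<bar>S $$ (i, ?s i)\<bar>"
      unfolding real_sqrt_mult[symmetric] using xy[OF that] by (metis real_sqrt_abs)
    then show ?thesis
      unfolding tail[OF that] head[OF that] by (simp split: if_splits)
  qed
  have "phi m (complex_of_facets (cycle_edges m)) \<gamma> = S"
  proof (rule eq_matI)
    fix i j assume "i < dim_row S" "j < dim_col S"
    then have ij: "i < m" "j < m" using S'(1) by auto
    show "phi m (complex_of_facets (cycle_edges m)) \<gamma> $$ (i, j) = S $$ (i, j)"
    proof (cases "i = j")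
      case True
      obtain k where k: "k < m" "j = ?s k" using suc_mod_surj[OF ij(2)] .
      have "x j + y k \<le> S $$ (j, j)" "0 \<le> x j" "0 \<le> y k"
        using xy[OF k(1)] xy[OF ij(2)] k by auto
      moreover have "(\<gamma> j {k, j})\<^sup>2 = y k"
        using head[OF k(1)] xy[OF k(1)] k by (simp add: power_mult_distrib)
      moreover have "\<gamma> j {j} = sqrt (S $$ (j, j) - x j - y k)"
        using p k by (simp add: \<gamma>_def)
      ultimately show ?thesis
        using True phi_diagonal[OF k, of \<gamma>] tail[OF ij(2)] by simp
    next
      case False
      show ?thesis
      proof (cases "{i, j} \<in> cycle_edges m")
        case True
        then obtain k where k: "k < m" "{i, j} = {k, ?s k}" by (auto simp: cycle_edges_def)
        then consider "i = k" "j = ?s k" | "j = k" "i = ?s k" by (auto simp: doubleton_eq_iff)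
        then have "\<gamma> i {i, j} * \<gamma> j {i, j} = S $$ (i, j)"
        proof cases
          case 2
          then show ?thesis
            using edge[OF k(1)] sym[OF ij] k(2) by (simp add: mult.commute)
        qed (use edge[OF k(1)] in simp)
        then show ?thesis using phi_off_diagonal[OF ij False] True by simp
      qed (use phi_off_diagonal[OF ij False] S'(2)[OF ij False] in simp)
    qed
  qed (use S'(1) in \<open>auto simp: phi_def\<close>)
  then show "S \<in> range (phi m (complex_of_facets (cycle_edges m)))"
    by (metis rangeI)
qed

lemma matching_sum_eq_cont:
  assumes S: "S \<in> psd_graph m (cycle_edges m)"
  shows "(\<Sum>M\<in>matchings (cycle_edges m).
       (- 1) ^ card M * (\<Prod>e\<in>M. (edge_entry S e)\<^sup>2) * (\<Prod>i\<in>{..<m} - \<Union>M. S $$ (i, i))) =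
    cont (\<lambda>i. S $$ (i, i)) (\<lambda>i. (S $$ (i, Suc i mod m))\<^sup>2) 0 (Suc m) -
    (S $$ (m - 1, Suc (m - 1) mod m))\<^sup>2 *
      cont (\<lambda>i. S $$ (i, i)) (\<lambda>i. (S $$ (i, Suc i mod m))\<^sup>2) 1 (m - 1)"
proof -
  note sym = psd_graph_sym[OF S]
  show ?thesis
    unfolding msum_def[symmetric]
  proof (rule msum_cycle[OF m])
    fix i assume i: "i < m"
    \<comment> \<open>\<open>edge_entry\<close> reads above the diagonal; at the closing edge the
      successor is the smaller index, so symmetry is needed.\<close>
    show "(edge_entry S {i, Suc i mod m})\<^sup>2 = (S $$ (i, Suc i mod m))\<^sup>2"
      using sym[OF i suc_mod(1)[OF i]] by (simp add: edge_entry_def min_def max_def)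
  qed
qed

end

theorem theorem5p3:
  fixes m :: nat and S :: "real mat"
  assumes "m \<ge> 3"
    and "S \<in> psd_graph m (cycle_edges m)"
  shows "S \<in> range (phi m (complex_of_facets (cycle_edges m))) \<longleftrightarrow>
    (\<Sum>M\<in>matchings (cycle_edges m).
       (- 1) ^ card M * (\<Prod>e\<in>M. (edge_entry S e)\<^sup>2) * (\<Prod>i\<in>{..<m} - \<Union>M. S $$ (i, i)))
    \<ge> 2 * (\<Prod>i<m. \<bar>S $$ (i, Suc i mod m)\<bar>)"
  unfolding phi_range_iff_cycle_split[OF assms] matching_sum_eq_cont[OF assms]
proof
  assume "cycle_split m (\<lambda>i. S $$ (i, i)) (\<lambda>i. S $$ (i, Suc i mod m))"
  from cycle_split_imp[OF _ this] show
    "2 * (\<Prod>i<m. \<bar>S $$ (i, Suc i mod m)\<bar>) \<le>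
      cont (\<lambda>i. S $$ (i, i)) (\<lambda>i. (S $$ (i, Suc i mod m))\<^sup>2) 0 (Suc m) -
      (S $$ (m - 1, Suc (m - 1) mod m))\<^sup>2 *
        cont (\<lambda>i. S $$ (i, i)) (\<lambda>i. (S $$ (i, Suc i mod m))\<^sup>2) 1 (m - 1)"
    using assms(1) by simp
next
  assume ineq: "2 * (\<Prod>i<m. \<bar>S $$ (i, Suc i mod m)\<bar>) \<le>
      cont (\<lambda>i. S $$ (i, i)) (\<lambda>i. (S $$ (i, Suc i mod m))\<^sup>2) 0 (Suc m) -
      (S $$ (m - 1, Suc (m - 1) mod m))\<^sup>2 *
        cont (\<lambda>i. S $$ (i, i)) (\<lambda>i. (S $$ (i, Suc i mod m))\<^sup>2) 1 (m - 1)"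
  note form = psd_graph_cycle_form[OF assms]
  show "cycle_split m (\<lambda>i. S $$ (i, i)) (\<lambda>i. S $$ (i, Suc i mod m))"
  proof (cases "\<exists>r<m. S $$ (r, Suc r mod m) = 0")
    case True
    then show ?thesis using cycle_split_zero_edge[OF form] by blast
  next
    case False
    then show ?thesis by (intro cycle_split_nonzero_edges[OF assms(1) form _ ineq]) auto
  qed
qed

end
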